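(* Let $R$ be a commutative ring with nonzero identity and let $[a]\in EC(R^\#)$. Then $[a]$ is an isolated point of $GD(R)$ if and only if one of the following conditions holds. (1) $R$ is a local ring with maximal ideal $\mathfrak m=\operatorname{Nil}(R)=aR$ such that $a^2=0$. In this case, $EC(R^\#)=\{[a]\}$. (2) $a$ is an $m$-irreducible von Neumann regular element.
   Context: For a commutative ring $R$ with nonzero identity and unit group $U(R)$, let $R^\#=R\setminus(U(R)\cup\{0\})$ be the set of nonzero nonunits. For $a,b\in R^\#$ write $a\sim b$ if $aR=bR$; $[a]$ denotes the equivalence class of $a$ and $EC(R^\#)$ the set of equivalence classes. For $a\in R^\#$ put $B_a=\{[b]\in EC(R^\#): b\mid a^n\text{ for some }n\geq 1\}$. The sets $B_a$ ($a\in R^\#$) form a basis of a topology on $EC(R^\#)$; the resulting space is denoted $GD(R)$ (the generalized divisor topology). A nonunit $a\in R$ is $m$-irreducible if $aR$ is maximal in the set of proper principal ideals of $R$; thus for $a\in R^\#$: $aR\subseteq bR\subsetneq R$ implies $aR=bR$. An element $a\in R$ is a von Neumann regular element if $a=a^2x$ for some $x\in R$. $\operatorname{Nil}(R)$ is the nilradical of $R$. "Local" means having a unique maximal ideal (no Noetherian hypothesis). *)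

theory Defs
  imports "HOL-Algebra.Ideal" "HOL-Algebra.Divisibility" "HOL-Analysis.Abstract_Topology"
begin

definition nonzero_nonunits :: "('a, 'b) ring_scheme \<Rightarrow> 'a set" where
  "nonzero_nonunits R = carrier R - (Units R \<union> {\<zero>\<^bsub>R\<^esub>})"

definition same_ideal_rel :: "('a, 'b) ring_scheme \<Rightarrow> ('a \<times> 'a) set" where
  "same_ideal_rel R =
     {(a, b) \<in> nonzero_nonunits R \<times> nonzero_nonunits R. PIdl\<^bsub>R\<^esub> a = PIdl\<^bsub>R\<^esub> b}"

definition EC :: "('a, 'b) ring_scheme \<Rightarrow> 'a set set" where
  "EC R = nonzero_nonunits R // same_ideal_rel R"

definition ec_class :: "('a, 'b) ring_scheme \<Rightarrow> 'a \<Rightarrow> 'a set" where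
  "ec_class R a = same_ideal_rel R `` {a}"

definition GD_basic :: "('a, 'b) ring_scheme \<Rightarrow> 'a \<Rightarrow> 'a set set" where
  "GD_basic R a =
     {ec_class R b | b. b \<in> nonzero_nonunits R \<and> (\<exists>n::nat. n \<ge> 1 \<and> b divides\<^bsub>R\<^esub> (a [^]\<^bsub>R\<^esub> n))}"

text \<open>
  \<open>topology_generated_by\<close> treats its argument as a subbasis. That the sets \<open>GD_basic R a\<close> are
  in fact a basis of the resulting topology on \<open>EC R\<close> is proved in \<open>openin_GD_iff\<close> and
  \<open>topspace_GD\<close> below.
\<close>

definition GD :: "('a, 'b) ring_scheme \<Rightarrow> 'a set topology" where
  "GD R = topology_generated_by (GD_basic R ` nonzero_nonunits R)"

definition isolated_point_of :: "'a topology \<Rightarrow> 'a \<Rightarrow> bool" where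
  "isolated_point_of X x \<longleftrightarrow> x \<in> topspace X \<and> openin X {x}"

definition m_irreducible :: "('a, 'b) ring_scheme \<Rightarrow> 'a \<Rightarrow> bool" where
  "m_irreducible R a \<longleftrightarrow> a \<in> carrier R \<and> a \<notin> Units R \<and>
     (\<forall>b \<in> carrier R. PIdl\<^bsub>R\<^esub> a \<subseteq> PIdl\<^bsub>R\<^esub> b \<and> PIdl\<^bsub>R\<^esub> b \<subset> carrier R \<longrightarrow> PIdl\<^bsub>R\<^esub> a = PIdl\<^bsub>R\<^esub> b)"

definition vonNeumann_regular :: "('a, 'b) ring_scheme \<Rightarrow> 'a \<Rightarrow> bool" where
  "vonNeumann_regular R a \<longleftrightarrow>
     a \<in> carrier R \<and> (\<exists>x \<in> carrier R. a = a [^]\<^bsub>R\<^esub> (2::nat) \<otimes>\<^bsub>R\<^esub> x)"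

definition nilradical :: "('a, 'b) ring_scheme \<Rightarrow> 'a set" where
  "nilradical R = {x \<in> carrier R. \<exists>n::nat. n \<ge> 1 \<and> x [^]\<^bsub>R\<^esub> n = \<zero>\<^bsub>R\<^esub>}"

definition is_local_ring :: "('a, 'b) ring_scheme \<Rightarrow> bool" where
  "is_local_ring R \<longleftrightarrow> (\<exists>!M. maximalideal M R)"

context cring
begin

lemma divides_iff_PIdl_subset:
  assumes "a \<in> carrier R" "b \<in> carrier R"
  shows "a divides b \<longleftrightarrow> PIdl b \<subseteq> PIdl a"
proof
  assume "a divides b"
  then obtain c where c: "c \<in> carrier R" "b = a \<otimes> c" by (auto simp: factor_def)
  show "PIdl b \<subseteq> PIdl a"
  proof
    fix y assume "y \<in> PIdl b"
    then obtain x where x: "x \<in> carrier R" "y = x \<otimes> b" by (auto simp: cgenideal_def)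
    have "y = (x \<otimes> c) \<otimes> a" using x c assms by (simp add: m_ac)
    then show "y \<in> PIdl a" using x c by (auto simp: cgenideal_def)
  qed
next
  assume "PIdl b \<subseteq> PIdl a"
  then have "b \<in> PIdl a" using cgenideal_self[OF assms(2)] by blast
  then show "a divides b" using assms by (auto simp: cgenideal_def factor_def m_comm)
qed

lemma equiv_same_ideal_rel: "equiv (nonzero_nonunits R) (same_ideal_rel R)"
  by (rule equivI) (auto simp: same_ideal_rel_def refl_on_def sym_def trans_def)

lemma ec_class_eq_iff:
  assumes "a \<in> nonzero_nonunits R" "b \<in> nonzero_nonunits R"
  shows "ec_class R a = ec_class R b \<longleftrightarrow> PIdl a = PIdl b"
  using assms by (auto simp: ec_class_def same_ideal_rel_def)

lemma ec_class_in_GD_basic_iff: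
  assumes a: "a \<in> nonzero_nonunits R" and b: "b \<in> nonzero_nonunits R"
  shows "ec_class R b \<in> GD_basic R a \<longleftrightarrow> (\<exists>n::nat. n \<ge> 1 \<and> b divides (a [^] n))"
proof
  assume "ec_class R b \<in> GD_basic R a"
  then obtain c n where c: "c \<in> nonzero_nonunits R" "ec_class R b = ec_class R c"
    and n: "n \<ge> 1" "c divides (a [^] (n::nat))" by (auto simp: GD_basic_def)
  then have "PIdl b = PIdl c" using ec_class_eq_iff b by blast
  moreover have "a \<in> carrier R" "b \<in> carrier R" "c \<in> carrier R"
    using a b c(1) by (auto simp: nonzero_nonunits_def)
  ultimately show "\<exists>n::nat. n \<ge> 1 \<and> b divides (a [^] n)"
    using n divides_iff_PIdl_subset[of c "a [^] n"] divides_iff_PIdl_subset[of b "a [^] n"]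
    by auto
qed (use b in \<open>auto simp: GD_basic_def\<close>)

lemma GD_basic_self:
  assumes "a \<in> nonzero_nonunits R"
  shows "ec_class R a \<in> GD_basic R a"
proof -
  have "a \<in> carrier R" using assms by (simp add: nonzero_nonunits_def)
  then have "a divides (a [^] (1::nat))" by simp
  then show ?thesis using ec_class_in_GD_basic_iff[OF assms assms] by blast
qed

lemma GD_basic_mono:
  assumes a: "a \<in> nonzero_nonunits R" and b: "b \<in> nonzero_nonunits R"
    and "ec_class R b \<in> GD_basic R a"
  shows "GD_basic R b \<subseteq> GD_basic R a"
proof
  fix u assume "u \<in> GD_basic R b"
  then obtain c k where c: "c \<in> nonzero_nonunits R" "u = ec_class R c"
    and k: "k \<ge> 1" "c divides (b [^] (k::nat))" by (auto simp: GD_basic_def)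
  obtain n where n: "n \<ge> 1" "b divides (a [^] (n::nat))"
    using assms ec_class_in_GD_basic_iff by blast
  have carr: "a \<in> carrier R" "b \<in> carrier R" "c \<in> carrier R"
    using a b c(1) by (auto simp: nonzero_nonunits_def)
  obtain d where d: "d \<in> carrier R" "a [^] n = b \<otimes> d" using n by (auto simp: factor_def)
  have "a [^] (n * k) = b [^] k \<otimes> d [^] k"
    using carr d(1) nat_pow_pow[of a n k] by (simp add: d(2) nat_pow_distrib)
  then have "b [^] k divides (a [^] (n * k))" using d by (auto simp: factor_def)
  then have "c divides (a [^] (n * k))"
    using divides_trans[OF k(2)] carr by simp
  moreover have "n * k \<ge> 1" using n k by simp
  ultimately show "u \<in> GD_basic R a" using c unfolding GD_basic_def by blast
qed

lemma EC_eq: "EC R = ec_class R ` nonzero_nonunits R"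
  by (auto simp: EC_def quotient_def ec_class_def)

lemma openin_GD_iff:
  "openin (GD R) U \<longleftrightarrow> (\<exists>A \<subseteq> nonzero_nonunits R. U = \<Union> (GD_basic R ` A))"
proof
  let ?N = "nonzero_nonunits R"
  assume "openin (GD R) U"
  then have "generate_topology_on (GD_basic R ` ?N) U"
    by (simp add: GD_def openin_topology_generated_by)
  then have star: "\<forall>u\<in>U. \<exists>a\<in>?N. u = ec_class R a \<and> GD_basic R a \<subseteq> U"
  proof (induct rule: generate_topology_on.induct)
    case (Int V W)
    show ?case
    proof
      fix u assume "u \<in> V \<inter> W"
      then have "u \<in> V" "u \<in> W" by simp_all
      obtain a where a: "a \<in> ?N" "u = ec_class R a" "GD_basic R a \<subseteq> V"
        using bspec[OF Int.hyps(2) \<open>u \<in> V\<close>] by (elim bexE conjE)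
      obtain b where b: "b \<in> ?N" "u = ec_class R b" "GD_basic R b \<subseteq> W"
        using bspec[OF Int.hyps(4) \<open>u \<in> W\<close>] by (elim bexE conjE)
      have "ec_class R a \<in> GD_basic R b" using GD_basic_self[OF b(1)] a(2) b(2) by simp
      then have "GD_basic R a \<subseteq> W" using GD_basic_mono[OF b(1) a(1)] b(3) by simp
      then show "\<exists>a\<in>?N. u = ec_class R a \<and> GD_basic R a \<subseteq> V \<inter> W"
        using a by (intro bexI[of _ a]) simp_all
    qed
  next
    case (UN K)
    show ?case
    proof
      fix u assume "u \<in> \<Union>K"
      then obtain k where k: "k \<in> K" "u \<in> k" by blast
      obtain a where a: "a \<in> ?N" "u = ec_class R a" "GD_basic R a \<subseteq> k"
        using bspec[OF UN.hyps(2)[OF k(1)] k(2)] by (elim bexE conjE)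
      have "GD_basic R a \<subseteq> \<Union>K" using a(3) k(1) by (rule order_trans[OF _ Union_upper])
      then show "\<exists>a\<in>?N. u = ec_class R a \<and> GD_basic R a \<subseteq> \<Union>K"
        using a by (intro bexI[of _ a]) simp_all
    qed
  next
    case (Basis S)
    then obtain a where a: "a \<in> ?N" "S = GD_basic R a" by blast
    show ?case
    proof
      fix u assume u: "u \<in> S"
      then obtain b where b: "b \<in> ?N" "u = ec_class R b" using a by (auto simp: GD_basic_def)
      then have "GD_basic R b \<subseteq> S" using GD_basic_mono[OF a(1) b(1)] a(2) u by simp
      then show "\<exists>b\<in>?N. u = ec_class R b \<and> GD_basic R b \<subseteq> S"
        using b by (intro bexI[of _ b]) simp_all
    qed
  next
    case Empty
    show ?case by simp
  qed
  have "U = \<Union> (GD_basic R ` {a \<in> ?N. GD_basic R a \<subseteq> U})"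
  proof (intro equalityI subsetI)
    fix u assume "u \<in> U"
    obtain a where a: "a \<in> ?N" "u = ec_class R a" "GD_basic R a \<subseteq> U"
      using bspec[OF star \<open>u \<in> U\<close>] by (elim bexE conjE)
    then show "u \<in> \<Union> (GD_basic R ` {a \<in> ?N. GD_basic R a \<subseteq> U})"
      using GD_basic_self[OF a(1)] by (intro UN_I[of a]) simp_all
  qed blast
  then show "\<exists>A \<subseteq> ?N. U = \<Union> (GD_basic R ` A)"
    by (intro exI[of _ "{a \<in> ?N. GD_basic R a \<subseteq> U}"]) simp
next
  assume "\<exists>A \<subseteq> nonzero_nonunits R. U = \<Union> (GD_basic R ` A)"
  then obtain A where A: "A \<subseteq> nonzero_nonunits R" "U = \<Union> (GD_basic R ` A)" by blast
  show "openin (GD R) U" unfolding A(2)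
  proof (rule openin_Union)
    fix V assume "V \<in> GD_basic R ` A"
    then have "V \<in> GD_basic R ` nonzero_nonunits R" using A(1) by blast
    then show "openin (GD R) V" unfolding GD_def by (rule topology_generated_by_Basis)
  qed
qed

lemma topspace_GD: "topspace (GD R) = EC R"
proof -
  have "\<Union> (GD_basic R ` nonzero_nonunits R) = ec_class R ` nonzero_nonunits R"
  proof (intro equalityI subsetI)
    fix u assume "u \<in> ec_class R ` nonzero_nonunits R"
    then show "u \<in> \<Union> (GD_basic R ` nonzero_nonunits R)" using GD_basic_self by blast
  qed (auto simp: GD_basic_def)
  then show ?thesis by (simp add: GD_def EC_eq topology_generated_by_topspace)
qed

end

end

theory Submission
  imports Defs
begin

text \<open>
  The basic set of \<open>a\<close> is the smallest open set containing the class of \<open>a\<close>. So the class of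
  \<open>a\<close> is isolated exactly when every nonzero nonunit dividing some power of \<open>a\<close> generates the
  same ideal as \<open>a\<close> (\<open>isolated_iff_divisors_of_powers\<close>). The two conditions of the theorem
  correspond to whether the element \<open>a\<^sup>2\<close>, itself a divisor of a power of \<open>a\<close>, is zero.

  If \<open>a\<^sup>2 = 0\<close>, every element of the ring divides \<open>a\<^sup>2\<close>, and isolation says that all nonzero
  nonunits generate \<open>aR\<close>. The nonunits then form the ideal \<open>aR\<close>, which makes the ring local,
  with all of \<open>aR\<close> nilpotent. Conversely, if \<open>aR\<close> is maximal and \<open>a\<^sup>2 = 0\<close>, then an element \<open>c\<close>
  outside \<open>aR\<close> satisfies \<open>1 = d a + y c\<close>, so \<open>y c = 1 - d a\<close> is a unit with inverse
  \<open>1 + d a\<close>; hence every nonunit is a multiple \<open>c a\<close>, which vanishes if \<open>c \<in> aR\<close> and is an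
  associate of \<open>a\<close> otherwise (\<open>all_associated_if_maximal_square_zero\<close>).

  If \<open>a\<^sup>2 \<noteq> 0\<close>, isolation gives \<open>a\<^sup>2R = aR\<close>, which is von Neumann regularity, and applied to the
  divisors of \<open>a\<close> itself it gives \<open>m\<close>-irreducibility. Conversely, for a von Neumann regular
  \<open>a\<close> every power of \<open>a\<close> divides \<open>a\<close>, so divisors of powers of \<open>a\<close> are divisors of \<open>a\<close>, and
  \<open>m\<close>-irreducibility applies to them.
\<close>

context cring
begin

section \<open>Isolated points in terms of divisibility\<close>

text \<open>
  An open set containing the class of \<open>a\<close> contains some \<open>GD_basic R c\<close> to which that class
  belongs, and then also \<open>GD_basic R a\<close>, because divisibility of powers is transitive. So only
  the basic set of \<open>a\<close> itself has to be examined.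
\<close>

lemma isolated_iff_divisors_of_powers:
  assumes a: "a \<in> nonzero_nonunits R"
  shows "isolated_point_of (GD R) (ec_class R a) \<longleftrightarrow>
    (\<forall>b\<in>nonzero_nonunits R. \<forall>n::nat. n \<ge> 1 \<and> b divides (a [^] n) \<longrightarrow> PIdl b = PIdl a)"
    (is "?isolated \<longleftrightarrow> ?divisors")
proof
  assume ?isolated
  then obtain A where A: "A \<subseteq> nonzero_nonunits R" "{ec_class R a} = \<Union> (GD_basic R ` A)"
    unfolding isolated_point_of_def openin_GD_iff by blast
  then obtain c where c: "c \<in> A" "ec_class R a \<in> GD_basic R c" by blast
  then have "GD_basic R a \<subseteq> GD_basic R c" using GD_basic_mono[OF _ a] A(1) by blast
  then have sub: "GD_basic R a \<subseteq> {ec_class R a}" using A(2) c(1) by blast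
  show ?divisors
  proof (intro ballI allI impI)
    fix b and n :: nat
    assume b: "b \<in> nonzero_nonunits R" and "n \<ge> 1 \<and> b divides (a [^] n)"
    then have "ec_class R b \<in> GD_basic R a" using ec_class_in_GD_basic_iff[OF a b] by blast
    then show "PIdl b = PIdl a" using sub ec_class_eq_iff[OF b a] by blast
  qed
next
  assume ?divisors
  then have "GD_basic R a \<subseteq> {ec_class R a}"
    using ec_class_eq_iff[OF _ a] unfolding GD_basic_def by blast
  then have "{ec_class R a} = \<Union> (GD_basic R ` {a})" using GD_basic_self[OF a] by blast
  then have "openin (GD R) {ec_class R a}" using a unfolding openin_GD_iff by blast
  then show ?isolated using a by (simp add: isolated_point_of_def topspace_GD EC_eq)
qed

section \<open>Ideals, units and local rings\<close>

lemma proper_ideal_no_Units: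
  assumes "ideal I R" "I \<noteq> carrier R"
  shows "I \<inter> Units R = {}"
proof (rule ccontr)
  assume "I \<inter> Units R \<noteq> {}"
  then obtain u where u: "u \<in> I" "u \<in> Units R" by blast
  then have "inv u \<otimes> u \<in> I" using ideal.I_l_closed[OF assms(1) u(1)] by blast
  then have "I = carrier R" using u(2) ideal.one_imp_carrier[OF assms(1)] by simp
  with assms(2) show False by contradiction
qed

lemma cgenideal_Units_iff:
  assumes "a \<in> carrier R"
  shows "PIdl a = carrier R \<longleftrightarrow> a \<in> Units R"
proof
  assume "PIdl a = carrier R"
  then have "\<one> \<in> PIdl a" by simp
  then obtain x where "x \<in> carrier R" "\<one> = x \<otimes> a" by (auto simp: cgenideal_def)
  then show "a \<in> Units R" using assms m_comm[of x a] unfolding Units_def by auto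
next
  assume "a \<in> Units R"
  then show "PIdl a = carrier R"
    using proper_ideal_no_Units[OF cgenideal_ideal[OF assms]] cgenideal_self[OF assms] by blast
qed

lemma cgenideal_zero: "PIdl \<zero> = {\<zero>}"
  unfolding cgenideal_def by (auto intro!: exI[of _ \<zero>])

lemma nonunits_ideal_maximal:
  assumes I: "ideal I R" and nonunits: "I = carrier R - Units R"
  shows "maximalideal I R" and "is_local_ring R"
proof -
  have in_I: "J \<subseteq> I" if "ideal J R" "J \<noteq> carrier R" for J
    using proper_ideal_no_Units[OF that] ideal.Icarr[OF that(1)] nonunits by blast
  have "carrier R \<noteq> I" using nonunits Units_one_closed by blast
  then show max: "maximalideal I R"
    using in_I by (intro maximalidealI I) blast+
  have "J = I" if "maximalideal J R" for J
  proof -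
    interpret J: maximalideal J R by (rule that)
    have "J \<subseteq> I" using in_I[OF J.is_ideal] J.I_notcarr by blast
    then show ?thesis
      using J.I_maximal[OF I] ideal.Icarr[OF I] \<open>carrier R \<noteq> I\<close> by blast
  qed
  with max show "is_local_ring R" unfolding is_local_ring_def by blast
qed

section \<open>Generators of square zero\<close>

lemma one_minus_square_zero_Unit:
  assumes m: "m \<in> carrier R" and sq: "m \<otimes> m = \<zero>"
  shows "\<one> \<ominus> m \<in> Units R"
proof -
  have "(\<one> \<ominus> m) \<otimes> (\<one> \<oplus> m) = \<one> \<ominus> m \<otimes> m" using m by algebra
  then have "(\<one> \<ominus> m) \<otimes> (\<one> \<oplus> m) = \<one>" using sq by (simp add: minus_eq)
  moreover from this have "(\<one> \<oplus> m) \<otimes> (\<one> \<ominus> m) = \<one>" using m by (simp add: m_comm)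
  ultimately show ?thesis using m unfolding Units_def by auto
qed

text \<open>
  Modulo \<open>aR\<close> the ring is a field, and units lift along the nilpotent ideal \<open>aR\<close>.
\<close>

lemma Unit_if_outside_maximal_square_zero:
  assumes a: "a \<in> carrier R" and max: "maximalideal (PIdl a) R" and sq: "a \<otimes> a = \<zero>"
    and c: "c \<in> carrier R" "c \<notin> PIdl a"
  shows "c \<in> Units R"
proof -
  let ?J = "PIdl a <+>\<^bsub>R\<^esub> PIdl c"
  have J: "ideal ?J R" using a c by (intro add_ideals cgenideal_ideal)
  have mem: "x \<otimes> a \<oplus> y \<otimes> c \<in> ?J" if "x \<in> carrier R" "y \<in> carrier R" for x y
    using that unfolding set_add_def' cgenideal_def by blast
  have "PIdl a \<subseteq> ?J"
  proof
    fix u assume "u \<in> PIdl a"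
    then obtain x where "x \<in> carrier R" "u = x \<otimes> a" by (auto simp: cgenideal_def)
    then show "u \<in> ?J" using mem[of x \<zero>] a c by simp
  qed
  moreover have "c \<in> ?J" using mem[of \<zero> \<one>] a c by simp
  ultimately have "?J = carrier R"
    using maximalideal.I_maximal[OF max J] ideal.Icarr[OF J] c(2) by blast
  then have "\<one> \<in> ?J" by simp
  then obtain x y where xy: "x \<in> carrier R" "y \<in> carrier R" "\<one> = x \<otimes> a \<oplus> y \<otimes> c"
    unfolding set_add_def' cgenideal_def by blast
  have "(x \<otimes> a \<oplus> y \<otimes> c) \<ominus> x \<otimes> a = y \<otimes> c" using xy(1,2) a c by algebra
  then have "y \<otimes> c = \<one> \<ominus> x \<otimes> a" using xy(3) by simp
  moreover have "(x \<otimes> a) \<otimes> (x \<otimes> a) = (x \<otimes> x) \<otimes> (a \<otimes> a)" using xy a by (simp add: m_ac)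
  then have "(x \<otimes> a) \<otimes> (x \<otimes> a) = \<zero>" using sq xy by simp
  ultimately have "y \<otimes> c \<in> Units R"
    using one_minus_square_zero_Unit[of "x \<otimes> a"] m_closed[OF xy(1) a] by metis
  then show ?thesis using xy c unit_factor[of c y] by (simp add: m_comm)
qed

lemma all_associated_if_maximal_square_zero:
  assumes a: "a \<in> carrier R" and max: "maximalideal (PIdl a) R" and sq: "a \<otimes> a = \<zero>"
    and b: "b \<in> nonzero_nonunits R"
  shows "PIdl b = PIdl a"
proof -
  have bR: "b \<in> carrier R" "b \<notin> Units R" "b \<noteq> \<zero>"
    using b by (auto simp: nonzero_nonunits_def)
  then have "b \<in> PIdl a"
    using Unit_if_outside_maximal_square_zero[OF a max sq] by blast
  then obtain c where c: "c \<in> carrier R" "b = c \<otimes> a" by (auto simp: cgenideal_def)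
  have "c \<notin> PIdl a"
  proof
    assume "c \<in> PIdl a"
    then obtain d where "d \<in> carrier R" "c = d \<otimes> a" by (auto simp: cgenideal_def)
    then have "b = \<zero>" using c a sq by (simp add: m_assoc)
    then show False using bR by simp
  qed
  then have unit: "c \<in> Units R"
    using Unit_if_outside_maximal_square_zero[OF a max sq c(1)] by blast
  have "a = b \<otimes> inv c" using unit c a by (simp add: m_ac Units_r_inv)
  then have "b divides a" using unit by (intro dividesI) auto
  moreover have "a divides b" using c a by (intro dividesI[of c]) (auto simp: m_comm)
  ultimately show ?thesis using divides_iff_PIdl_subset a bR by blast
qed

text \<open>
  Since every element divides \<open>a\<^sup>2 = 0\<close>, the basic set of \<open>a\<close> is the whole space; the hypothesis
  \<open>all\<close> is what isolation of the class of \<open>a\<close> then amounts to.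
\<close>

lemma local_if_all_associated_square_zero:
  assumes "\<one> \<noteq> \<zero>" and a: "a \<in> nonzero_nonunits R" and sq: "a \<otimes> a = \<zero>"
    and all: "\<And>b. b \<in> nonzero_nonunits R \<Longrightarrow> PIdl b = PIdl a"
  shows "is_local_ring R" and "maximalideal (PIdl a) R" and "PIdl a = nilradical R"
proof -
  have aR: "a \<in> carrier R" "a \<notin> Units R" using a by (auto simp: nonzero_nonunits_def)
  have I: "ideal (PIdl a) R" by (rule cgenideal_ideal[OF aR(1)])
  have nonunits: "PIdl a = carrier R - Units R"
  proof (intro equalityI subsetI)
    fix b assume "b \<in> PIdl a"
    then show "b \<in> carrier R - Units R"
      using proper_ideal_no_Units[OF I] cgenideal_Units_iff aR ideal.Icarr[OF I] by blast
  next
    fix b assume b: "b \<in> carrier R - Units R"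
    show "b \<in> PIdl a"
    proof (cases "b = \<zero>")
      case True
      then show ?thesis using additive_subgroup.zero_closed[OF ideal.axioms(1)[OF I]] by simp
    next
      case False
      then show ?thesis using b all[of b] cgenideal_self[of b] by (simp add: nonzero_nonunits_def)
    qed
  qed
  show "is_local_ring R" "maximalideal (PIdl a) R"
    using nonunits_ideal_maximal[OF I nonunits] by blast+
  show "PIdl a = nilradical R"
  proof (intro equalityI subsetI)
    fix b assume "b \<in> PIdl a"
    then obtain x where x: "x \<in> carrier R" "b = x \<otimes> a" by (auto simp: cgenideal_def)
    then have "b \<otimes> b = (x \<otimes> x) \<otimes> (a \<otimes> a)" using aR by (simp add: m_ac)
    then have "b [^] (2::nat) = \<zero>" using x aR sq by (simp add: numeral_2_eq_2)
    then show "b \<in> nilradical R"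
      using x aR unfolding nilradical_def by (auto intro!: exI[of _ 2])
  next
    fix b assume "b \<in> nilradical R"
    then obtain n :: nat where b: "b \<in> carrier R" "b [^] n = \<zero>"
      unfolding nilradical_def by blast
    have "b \<notin> Units R"
    proof
      assume "b \<in> Units R"
      then have "b [^] n \<in> Units R" by (induction n) simp_all
      then have "\<zero> \<in> Units R" using b(2) by simp
      then have "\<one> = \<zero>" using Units_l_inv_ex by force
      with assms(1) show False by contradiction
    qed
    then show "b \<in> PIdl a" using b nonunits by blast
  qed
qed

section \<open>Von Neumann regular elements\<close>

lemma vonNeumann_regular_pow_divides:
  assumes "vonNeumann_regular R a"
  shows "a [^] (n::nat) divides a"
proof -
  obtain x where a: "a \<in> carrier R" and x: "x \<in> carrier R" "a = a \<otimes> a \<otimes> x"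
    using assms unfolding vonNeumann_regular_def by (auto simp: numeral_2_eq_2)
  show ?thesis
  proof (induction n)
    case 0
    show ?case using a by (intro dividesI[of a]) simp_all
  next
    case (Suc n)
    then obtain y where y: "y \<in> carrier R" "a = a [^] n \<otimes> y" by (auto simp: factor_def)
    have "a = a \<otimes> a \<otimes> x" by (rule x(2))
    also have "\<dots> = a \<otimes> (a [^] n \<otimes> y) \<otimes> x" using y(2) by simp
    also have "\<dots> = a [^] Suc n \<otimes> (y \<otimes> x)" using a x(1) y(1) by (simp add: m_ac)
    finally show ?case using x y by (intro dividesI[of "y \<otimes> x"]) simp_all
  qed
qed

lemma isolated_if_m_irreducible_regular:
  assumes a: "a \<in> nonzero_nonunits R" and "m_irreducible R a" and reg: "vonNeumann_regular R a"
  shows "isolated_point_of (GD R) (ec_class R a)"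
  unfolding isolated_iff_divisors_of_powers[OF a]
proof (intro ballI allI impI)
  fix b and n :: nat
  assume b: "b \<in> nonzero_nonunits R" and "n \<ge> 1 \<and> b divides (a [^] n)"
  then have ab: "a \<in> carrier R" "b \<in> carrier R" "b \<notin> Units R" "b divides (a [^] n)"
    using a by (auto simp: nonzero_nonunits_def)
  then have "b divides a"
    using divides_trans[OF ab(4) vonNeumann_regular_pow_divides[OF reg]] by simp
  then have "PIdl a \<subseteq> PIdl b" using divides_iff_PIdl_subset ab by blast
  moreover have "PIdl b \<subset> carrier R"
    using ab cgenideal_Units_iff ideal.Icarr[OF cgenideal_ideal[of b]] by blast
  ultimately show "PIdl b = PIdl a" using assms(2) ab unfolding m_irreducible_def by blast
qed

lemma m_irreducible_if_isolated:
  assumes a: "a \<in> nonzero_nonunits R" and iso: "isolated_point_of (GD R) (ec_class R a)"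
  shows "m_irreducible R a"
  unfolding m_irreducible_def
proof (intro conjI ballI impI)
  show aR: "a \<in> carrier R" "a \<notin> Units R" using a by (auto simp: nonzero_nonunits_def)
  fix b assume b: "b \<in> carrier R" and sub: "PIdl a \<subseteq> PIdl b \<and> PIdl b \<subset> carrier R"
  then have "b \<notin> Units R" using cgenideal_Units_iff by blast
  moreover have "b \<noteq> \<zero>"
    using sub cgenideal_self[OF aR(1)] cgenideal_zero a by (auto simp: nonzero_nonunits_def)
  ultimately have "b \<in> nonzero_nonunits R" using b by (simp add: nonzero_nonunits_def)
  moreover have "b divides (a [^] (1::nat))" using sub divides_iff_PIdl_subset aR b by simp
  ultimately show "PIdl a = PIdl b"
    using iso unfolding isolated_iff_divisors_of_powers[OF a] by (metis order_refl)
qed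

lemma vonNeumann_regular_if_isolated:
  assumes a: "a \<in> nonzero_nonunits R" and iso: "isolated_point_of (GD R) (ec_class R a)"
    and sq: "a [^] (2::nat) \<noteq> \<zero>"
  shows "vonNeumann_regular R a"
proof -
  have aR: "a \<in> carrier R" "a \<notin> Units R" using a by (auto simp: nonzero_nonunits_def)
  then have "a [^] (2::nat) \<notin> Units R" using unit_factor[of a a] by (auto simp: numeral_2_eq_2)
  then have "a [^] (2::nat) \<in> nonzero_nonunits R"
    using aR sq by (simp add: nonzero_nonunits_def)
  moreover have "a [^] (2::nat) divides (a [^] (2::nat))" using aR by simp
  moreover have "(2::nat) \<ge> 1" by simp
  ultimately have "PIdl (a [^] (2::nat)) = PIdl a"
    using iso unfolding isolated_iff_divisors_of_powers[OF a] by blast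
  then have "a [^] (2::nat) divides a" using divides_iff_PIdl_subset aR by simp
  then show ?thesis using aR unfolding vonNeumann_regular_def by (auto simp: factor_def)
qed

end

section \<open>Characterization of the isolated points\<close>

theorem proposition3p1:
  fixes R :: "('a, 'b) ring_scheme" (structure) and a :: 'a
  assumes "cring R" and "\<one> \<noteq> \<zero>"
    and "a \<in> nonzero_nonunits R"
  shows "(isolated_point_of (GD R) (ec_class R a) \<longleftrightarrow>
            (is_local_ring R \<and>
              (\<exists>M. maximalideal M R \<and> M = nilradical R \<and> M = PIdl a \<and> a [^] (2::nat) = \<zero>)) \<or>
            (m_irreducible R a \<and> vonNeumann_regular R a)) \<and>
         (is_local_ring R \<and>
            (\<exists>M. maximalideal M R \<and> M = nilradical R \<and> M = PIdl a \<and> a [^] (2::nat) = \<zero>) \<longrightarrow>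
          EC R = {ec_class R a})"
    (is "(?isolated \<longleftrightarrow> ?local \<or> ?regular) \<and> (?local \<longrightarrow> ?one_class)")
proof -
  interpret cring R by (rule assms(1))
  note a = assms(3)
  have aR: "a \<in> carrier R" using a by (simp add: nonzero_nonunits_def)
  have pow2: "a [^] (2::nat) = a \<otimes> a" using aR by (simp add: numeral_2_eq_2)
  have all: "PIdl b = PIdl a" if ?local "b \<in> nonzero_nonunits R" for b
    using that all_associated_if_maximal_square_zero[OF aR] pow2 by auto
  have "?local \<or> ?regular" if iso: ?isolated
  proof (cases "a [^] (2::nat) = \<zero>")
    case True
    have "PIdl b = PIdl a" if b: "b \<in> nonzero_nonunits R" for b
    proof -
      have "b divides (a [^] (2::nat))"
        using True b by (intro dividesI[of \<zero>]) (simp_all add: nonzero_nonunits_def)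
      moreover have "(2::nat) \<ge> 1" by simp
      ultimately show ?thesis
        using iso b unfolding isolated_iff_divisors_of_powers[OF a] by blast
    qed
    then have ?local
      using local_if_all_associated_square_zero[OF assms(2) a] True pow2 by auto
    then show ?thesis ..
  next
    case False
    then show ?thesis
      using m_irreducible_if_isolated[OF a iso] vonNeumann_regular_if_isolated[OF a iso] by blast
  qed
  moreover have ?isolated if ?local
    using all[OF that] unfolding isolated_iff_divisors_of_powers[OF a] by blast
  moreover have ?isolated if ?regular
    using that isolated_if_m_irreducible_regular[OF a] by blast
  moreover have ?one_class if ?local
    using all[OF that] ec_class_eq_iff[OF _ a] a unfolding EC_eq by blast
  ultimately show ?thesis by blast
qed

end
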